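(* Let $K$ be a convex origin-symmetric body in $\mathbb{R}^2$ with $\dim(K\cap\mathbb{Z}^2)=2$. Then $$\#K\;\le\;4\,\max_{\xi\in\mathbb{S}^1}\#(K\cap\xi^\perp)\;\mathrm{vol}_2(K)^{\frac12}.$$
   Context: A convex body in $\mathbb{R}^2$ is a convex compact subset equal to the closure of its interior; it is origin-symmetric if $K=-K$. For a set $A\subset\mathbb{R}^2$, $\#A=\mathrm{card}(A\cap\mathbb{Z}^2)$ and $\dim(A)$ is the dimension of the affine hull of $A$. $\mathrm{vol}_2$ is area, and for a unit vector $\xi\in\mathbb{S}^1$, $\xi^\perp=\{x\in\mathbb{R}^2: x\cdot\xi=0\}$. *)

theory Defs
  imports "HOL-Analysis.Analysis"
begin

definition convex_body :: "(real ^ 2) set \<Rightarrow> bool" where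
  "convex_body K \<longleftrightarrow> convex K \<and> compact K \<and> K = closure (interior K)"

definition origin_symmetric :: "(real ^ 2) set \<Rightarrow> bool" where
  "origin_symmetric K \<longleftrightarrow> K = uminus ` K"

definition lattice_Z2 :: "(real ^ 2) set" where
  "lattice_Z2 = {x. \<forall>i. x $ i \<in> \<int>}"

definition lattice_card :: "(real ^ 2) set \<Rightarrow> nat" where
  "lattice_card A = card (A \<inter> lattice_Z2)"

definition perp :: "real ^ 2 \<Rightarrow> (real ^ 2) set" where
  "perp \<xi> = {x. x \<bullet> \<xi> = 0}"

definition max_central_section :: "(real ^ 2) set \<Rightarrow> nat" where
  "max_central_section K = Max ((\<lambda>\<xi>. lattice_card (K \<inter> perp \<xi>)) ` sphere 0 1)"

text \<open>
  The maximum above is taken over infinitely many \<open>\<xi>\<close>. The next two lemmas show that for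
  bounded \<open>K\<close> the cardinalities are those of finite sets and only finitely many values occur,
  so that \<^const>\<open>Max\<close> is the actual maximum.
\<close>

lemma finite_Int_lattice_Z2:
  assumes "bounded K"
  shows "finite (K \<inter> lattice_Z2)"
proof -
  obtain B where B: "\<And>x. x \<in> K \<Longrightarrow> norm x \<le> B"
    using assms by (auto simp: bounded_iff)
  let ?I = "{-\<lceil>B\<rceil>..\<lceil>B\<rceil>}"
  have "K \<inter> lattice_Z2 \<subseteq> (\<lambda>(a, b). vector [of_int a, of_int b]) ` (?I \<times> ?I)"
  proof
    fix x assume x: "x \<in> K \<inter> lattice_Z2"
    have fl: "of_int \<lfloor>x $ i\<rfloor> = x $ i" for i
      using x by (auto simp: lattice_Z2_def elim: Ints_cases)
    have bd: "\<lfloor>x $ i\<rfloor> \<in> ?I" for i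
    proof -
      have "\<bar>x $ i\<bar> \<le> B"
        using x B component_le_norm_cart order_trans by blast
      then have "\<bar>real_of_int \<lfloor>x $ i\<rfloor>\<bar> \<le> of_int \<lceil>B\<rceil>"
        unfolding fl by linarith
      then show ?thesis by auto
    qed
    have "x = vector [of_int \<lfloor>x $ 1\<rfloor>, of_int \<lfloor>x $ 2\<rfloor>]"
      by (simp add: vec_eq_iff forall_2 fl)
    then show "x \<in> (\<lambda>(a, b). vector [of_int a, of_int b]) ` (?I \<times> ?I)"
      using bd by (intro image_eqI[where x = "(\<lfloor>x $ 1\<rfloor>, \<lfloor>x $ 2\<rfloor>)"]) auto
  qed
  then show ?thesis
    by (rule finite_subset) auto
qed

lemma finite_section_values:
  assumes "bounded K"
  shows "finite ((\<lambda>\<xi>. lattice_card (K \<inter> perp \<xi>)) ` sphere 0 1)"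
proof (rule finite_subset)
  show "(\<lambda>\<xi>. lattice_card (K \<inter> perp \<xi>)) ` sphere 0 1 \<subseteq> {..lattice_card K}"
    using finite_Int_lattice_Z2[OF assms]
    by (auto simp: lattice_card_def intro!: card_mono)
qed simp

end

theory Submission
  imports Defs
begin

text \<open>
  Let \<open>M\<close> be the largest number of lattice points of \<open>K\<close> on a line through the origin, and
  \<open>N\<close> the number of all lattice points of \<open>K\<close>.
  If two lattice points of \<open>K\<close> are congruent modulo \<open>2 * n\<close>, then half their difference is
  \<open>n\<close> times a lattice point and lies in \<open>K\<close>; unless it is zero, the line through it carries at
  least \<open>2 * n + 1\<close> lattice points of \<open>K\<close>. For \<open>n = \<lfloor>(M + 1) / 2\<rfloor>\<close> that is impossible, hence \<open>N \<le> (M + 1)\<^sup>2\<close>.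
  On the other hand \<open>K\<close> contains a basis \<open>u\<close>, \<open>v\<close> of the integer lattice, and the translates of
  \<open>{s u + t v. \<bar>s\<bar>, \<bar>t\<bar> < 1/4}\<close> by half the lattice points of \<open>K\<close> are disjoint, contained in
  \<open>K\<close>, and have area \<open>1/4\<close>. Hence \<open>N \<le> 4 vol K\<close>, and multiplying the two estimates gives
  \<open>N\<^sup>2 \<le> 4 (M + 1)\<^sup>2 vol K\<close>, while \<open>M + 1 \<le> 2 M\<close>.
\<close>

text \<open>This is the determinant of the pair. It is an integer on lattice vectors, and the value
  1 says that they form a basis of the lattice.\<close>

definition wedge :: "real ^ 2 \<Rightarrow> real ^ 2 \<Rightarrow> real" where
  "wedge x y = x $ 1 * y $ 2 - x $ 2 * y $ 1"

lemma lattice_Z2_iff: "x \<in> lattice_Z2 \<longleftrightarrow> x $ 1 \<in> \<int> \<and> x $ 2 \<in> \<int>"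
  by (simp add: lattice_Z2_def forall_2)

lemma wedge_in_Ints: "x \<in> lattice_Z2 \<Longrightarrow> y \<in> lattice_Z2 \<Longrightarrow> wedge x y \<in> \<int>"
  by (simp add: lattice_Z2_iff wedge_def)

lemma wedge_eq_inner: "wedge x y = vector [- (x $ 2), x $ 1] \<bullet> y"
  by (simp add: wedge_def inner_vec_def sum_2)

lemma convex_symmetric_combination:
  fixes K :: "'a::real_vector set"
  assumes K: "convex K" "\<forall>x\<in>K. - x \<in> K"
    and xy: "x \<in> K" "y \<in> K" and st: "\<bar>s\<bar> + \<bar>t\<bar> \<le> 1"
  shows "s *\<^sub>R x + t *\<^sub>R y \<in> K"
proof -
  have zero: "0 \<in> K"
    using convexD[OF K(1) xy(1) bspec[OF K(2) xy(1)], of "1/2" "1/2"] by simp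
  have abs_scale: "\<exists>z'\<in>K. r *\<^sub>R z = \<bar>r\<bar> *\<^sub>R z'" if "z \<in> K" for r z
    using that K(2) by (cases "0 \<le> r") (auto intro: bexI[of _ "- z"] bexI[of _ z])
  obtain x' y' where x': "x' \<in> K" "s *\<^sub>R x = \<bar>s\<bar> *\<^sub>R x'" and y': "y' \<in> K" "t *\<^sub>R y = \<bar>t\<bar> *\<^sub>R y'"
    using abs_scale xy by metis
  have "\<bar>s\<bar> *\<^sub>R x' + \<bar>t\<bar> *\<^sub>R y' \<in> K"
  proof (cases "\<bar>s\<bar> + \<bar>t\<bar> = 0")
    case True
    then have "s = 0" "t = 0" by auto
    then show ?thesis using zero by simp
  next
    case False
    define r where "r = \<bar>s\<bar> + \<bar>t\<bar>"
    have r: "0 < r" "r \<le> 1" "\<bar>s\<bar> + \<bar>t\<bar> = r" using False st by (auto simp: r_def)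
    have "(\<bar>s\<bar> / r) *\<^sub>R x' + (\<bar>t\<bar> / r) *\<^sub>R y' \<in> K"
      using r by (intro convexD K x' y') (auto simp flip: add_divide_distrib)
    from convexD[OF K(1) this zero, of r "1 - r"]
    have "r *\<^sub>R ((\<bar>s\<bar> / r) *\<^sub>R x' + (\<bar>t\<bar> / r) *\<^sub>R y') + (1 - r) *\<^sub>R 0 \<in> K"
      using r by simp
    then show ?thesis using r by (simp add: scaleR_add_right)
  qed
  then show ?thesis by (simp add: x' y')
qed

text \<open>For a nonzero \<open>x\<close> in \<open>S\<close> the vectors \<open>y\<close> with
  \<open>wedge x y = 0\<close> form a line, and a set of dimension 2 fits into no line.\<close>

lemma wedge_nonzero_if_aff_dim_2:
  assumes "aff_dim S = 2"
  obtains x y where "x \<in> S" "y \<in> S" "wedge x y \<noteq> 0"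
proof -
  have "\<not> S \<subseteq> {0}"
    using aff_dim_subset[of S "{0}"] assms by auto
  then obtain x where x: "x \<in> S" "x \<noteq> 0" by auto
  have nz: "vector [- (x $ 2), x $ 1] \<noteq> (0 :: real ^ 2)"
    using x(2) by (auto simp: vec_eq_iff forall_2)
  have "\<not> S \<subseteq> {y. vector [- (x $ 2), x $ 1] \<bullet> y = 0}"
    using aff_dim_subset[of S "{y. vector [- (x $ 2), x $ 1] \<bullet> y = 0}"] assms
      aff_dim_hyperplane[OF nz, of 0] by auto
  then show thesis
    using x(1) that by (auto simp: wedge_eq_inner)
qed

text \<open>Shortening \<open>a\<close> to a primitive vector \<open>u\<close> keeps it in
  \<open>K\<close>. It can be completed to a basis by some \<open>w\<close>, possibly outside
  \<open>K\<close>; adding a suitable multiple of \<open>u\<close> then brings \<open>w\<close> into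
  \<open>K\<close>.\<close>

lemma unimodular_pair_exists:
  assumes K: "convex K" "\<forall>x\<in>K. - x \<in> K"
    and a: "a \<in> K \<inter> lattice_Z2" and b: "b \<in> K \<inter> lattice_Z2" and ab: "wedge a b \<noteq> 0"
  obtains u v where "u \<in> K \<inter> lattice_Z2" "v \<in> K \<inter> lattice_Z2" "wedge u v = 1"
proof -
  obtain p q where p: "a $ 1 = of_int p" and q: "a $ 2 = of_int q"
    using a by (auto simp: lattice_Z2_iff elim!: Ints_cases)
  have pq: "p \<noteq> 0 \<or> q \<noteq> 0" using ab p q by (auto simp: wedge_def)
  define g where "g = gcd p q"
  have g: "g > 0" using pq by (auto simp: g_def)
  obtain p' q' where p': "p = g * p'" and q': "q = g * q'"
    by (metis g_def gcd_dvd1 gcd_dvd2 dvdE)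
  obtain s r where "s * p + r * q = g"
    unfolding g_def using bezout_int by blast
  then have "g * (s * p' + r * q') = g * 1" by (simp add: p' q' algebra_simps)
  then have bez: "s * p' + r * q' = 1" using g by (metis mult_cancel_left less_irrefl)
  define u :: "real ^ 2" where "u = vector [of_int p', of_int q']"
  \<comment> \<open>The Bezout coefficients are arranged so that \<open>wedge u w\<close> becomes
    \<open>s * p' + r * q'\<close>.\<close>
  define w :: "real ^ 2" where "w = vector [- of_int r, of_int s]"
  have uw: "wedge u w = 1"
    using arg_cong[OF bez, of real_of_int] by (simp add: wedge_def u_def w_def algebra_simps)
  have au: "a = of_int g *\<^sub>R u"
    using p q p' q' by (simp add: u_def vec_eq_iff forall_2)
  have "(1 / of_int g) *\<^sub>R a + 0 *\<^sub>R a \<in> K"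
    using g a by (intro convex_symmetric_combination K) auto
  then have uK: "u \<in> K" using g by (simp add: au)
  have lat: "u \<in> lattice_Z2" "w \<in> lattice_Z2"
    by (auto simp: u_def w_def lattice_Z2_iff)
  have "wedge u b \<noteq> 0" using ab by (auto simp: au wedge_def)
  then obtain c where c: "c \<in> K" "c \<in> lattice_Z2" "wedge u c > 0"
  proof (cases "wedge u b > 0")
    case False
    then have "wedge u (- b) > 0" using \<open>wedge u b \<noteq> 0\<close> by (simp add: wedge_def)
    then show thesis using that[of "- b"] b K(2) by (simp add: lattice_Z2_iff)
  qed (use b that in blast)
  define h where "h = wedge u c"
  have "h \<in> \<int>" using wedge_in_Ints lat c by (simp add: h_def)
  show thesis
  proof (cases "h = 1")
    case True
    then show thesis using that[of u c] uK lat c by (simp add: h_def)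
  next
    case False
    have h2: "h \<ge> 2"
      using \<open>h \<in> \<int>\<close> False c(3) by (auto simp: h_def[symmetric] elim!: Ints_cases)
    define \<alpha> where "\<alpha> = wedge c w"
    \<comment> \<open>Call \<open>wedge u x\<close> the height of \<open>x\<close>. The points
      \<open>w + j u\<close> have height 1, and so has \<open>c / h = w + (\<alpha> / h) u\<close>,
      which lies in \<open>K\<close>. The nearest choice of \<open>j\<close> is off by at most
      \<open>u / 2\<close>, and \<open>h >= 2\<close> leaves just enough weight for that.\<close>
    define j where "j = round (\<alpha> / h)"
    have c_eq: "c = \<alpha> *\<^sub>R u + h *\<^sub>R w"
    proof -
      \<comment> \<open>Cramer's rule, kept as a polynomial identity with the factor
        \<open>wedge u w\<close>, which is then replaced by 1.\<close>
      have "wedge u w * c $ i = (\<alpha> *\<^sub>R u + h *\<^sub>R w) $ i" for i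
        using exhaust_2[of i] by (auto simp: \<alpha>_def h_def wedge_def algebra_simps)
      then show ?thesis by (simp add: uw vec_eq_iff)
    qed
    define v where "v = w + of_int j *\<^sub>R u"
    have v_eq: "v = (1 / h) *\<^sub>R c + (of_int j - \<alpha> / h) *\<^sub>R u"
      using h2 by (simp add: v_def c_eq algebra_simps)
    have "1 / h \<le> 1 / 2" using h2 by (simp add: field_simps)
    moreover have "\<bar>of_int j - \<alpha> / h\<bar> \<le> 1 / 2"
      unfolding j_def by (rule of_int_round_abs_le)
    moreover have "\<bar>1 / h\<bar> = 1 / h" using h2 by simp
    ultimately have "\<bar>1 / h\<bar> + \<bar>of_int j - \<alpha> / h\<bar> \<le> 1" by linarith
    then have "v \<in> K"
      unfolding v_eq by (intro convex_symmetric_combination K c uK)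
    moreover have "v \<in> lattice_Z2" using lat by (simp add: v_def lattice_Z2_iff)
    moreover have "wedge u v = 1" using uw by (simp add: v_def wedge_def algebra_simps)
    ultimately show thesis using that uK lat by blast
  qed
qed

lemma card_lattice_le_measure:
  assumes K: "convex K" "\<forall>x\<in>K. - x \<in> K" "compact K"
    and u: "u \<in> K \<inter> lattice_Z2" and v: "v \<in> K \<inter> lattice_Z2" and uv: "wedge u v = 1"
  shows "real (lattice_card K) \<le> 4 * measure lebesgue K"
proof -
  define f where "f = (\<lambda>z :: real ^ 2. z $ 1 *\<^sub>R u + z $ 2 *\<^sub>R v)"
  define B :: "(real ^ 2) set" where "B = box (vec (- (1 / 4))) (vec (1 / 4))"
  define A where "A = (\<lambda>x. (+) ((1 / 2) *\<^sub>R x) ` f ` B)"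
  let ?L = "K \<inter> lattice_Z2"
  have fin: "finite ?L"
    using K(3) by (intro finite_Int_lattice_Z2 compact_imp_bounded)
  have lin: "linear f"
    by (rule linearI) (simp_all add: f_def algebra_simps)
  have B_iff: "z \<in> B \<longleftrightarrow> \<bar>z $ 1\<bar> < 1 / 4 \<and> \<bar>z $ 2\<bar> < 1 / 4" for z
    by (auto simp: B_def mem_box_cart forall_2)
  have "measure lebesgue B = measure lborel (cbox (vec (- (1 / 4))) (vec (1 / 4)) :: (real ^ 2) set)"
    by (simp add: B_def measure_lborel_box_eq measure_lborel_cbox_eq)
  also have "\<dots> = 1 / 4"
    by (subst content_cbox_cart)
       (auto simp: interval_ne_empty_cart UNIV_2)
  finally have B: "measure lebesgue B = 1 / 4" .
  \<comment> \<open>The columns of the matrix are \<open>u\<close> and \<open>v\<close>, so its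
    determinant is \<open>wedge u v\<close> and \<open>f\<close> preserves area.\<close>
  have "det (matrix f) = 1"
    using uv by (simp add: det_2 matrix_def f_def axis_def wedge_def mult.commute)
  moreover have Bm: "B \<in> lmeasurable" by (simp add: B_def)
  ultimately have fB: "measure lebesgue (f ` B) = 1 / 4"
    using measure_linear_image[OF lin] B by simp
  have Am: "A x \<in> lmeasurable" for x
    unfolding A_def by (intro measurable_translation measurable_linear_image lin Bm)
  have mA: "measure lebesgue (A x) = 1 / 4" for x
    by (simp add: A_def fB measure_translation)
  have sub: "A x \<subseteq> K" if "x \<in> K" for x
  proof
    fix y assume "y \<in> A x"
    then obtain z where z: "z \<in> B" "y = (1 / 2) *\<^sub>R x + f z" by (auto simp: A_def)
    \<comment> \<open>The point \<open>y\<close> is the midpoint of \<open>x\<close> and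
      \<open>2 f z\<close>. The side bound 1/4 of \<open>B\<close> is what keeps the two weights of
      \<open>2 f z\<close> below 1 in sum.\<close>
    have "(2 * z $ 1) *\<^sub>R u + (2 * z $ 2) *\<^sub>R v \<in> K"
      using u v z(1) by (intro convex_symmetric_combination K) (auto simp: B_iff)
    from convexD[OF K(1) that this, of "1 / 2" "1 / 2"]
    have "(1 / 2) *\<^sub>R x + (1 / 2) *\<^sub>R ((2 * z $ 1) *\<^sub>R u + (2 * z $ 2) *\<^sub>R v) \<in> K"
      by simp
    then show "y \<in> K" by (simp add: z f_def algebra_simps)
  qed
  have disj: "x = y" if xy: "x \<in> ?L" "y \<in> ?L" and meet: "A x \<inter> A y \<noteq> {}" for x y
  proof -
    obtain p q where p: "p \<in> B" and q: "q \<in> B" and eq: "(1 / 2) *\<^sub>R x + f p = (1 / 2) *\<^sub>R y + f q"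
      using meet unfolding A_def by blast
    \<comment> \<open>The entries of \<open>z\<close> are the coordinates of \<open>x - y\<close> in
      the basis \<open>u\<close>, \<open>v\<close>, hence integers. Since \<open>B\<close> is open
      they are strictly below 1 in absolute value, so they vanish.\<close>
    define z where "z = 2 *\<^sub>R (q - p)"
    have "f z = 2 *\<^sub>R (f q - f p)"
      by (simp add: z_def linear_cmul[OF lin] linear_diff[OF lin])
    also have "f q - f p = (1 / 2) *\<^sub>R (x - y)"
      using eq by (simp add: algebra_simps)
    finally have fz: "f z = x - y" by simp
    have lat: "f z \<in> lattice_Z2" using xy by (simp add: fz lattice_Z2_iff)
    have z_eq: "wedge (f z) v = z $ 1" "wedge u (f z) = z $ 2"
    proof -
      have "wedge (f z) v = z $ 1 * wedge u v" "wedge u (f z) = z $ 2 * wedge u v"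
        by (simp_all add: f_def wedge_def algebra_simps)
      then show "wedge (f z) v = z $ 1" "wedge u (f z) = z $ 2" by (simp_all add: uv)
    qed
    have "z $ 1 \<in> \<int>" "z $ 2 \<in> \<int>"
      using lat u v wedge_in_Ints by (auto simp flip: z_eq)
    moreover have "\<bar>z $ 1\<bar> < 1" "\<bar>z $ 2\<bar> < 1"
      using p q by (auto simp: B_iff z_def)
    ultimately have "z $ 1 = 0" "z $ 2 = 0" by (auto elim!: Ints_cases)
    then have "f z = 0" by (simp add: f_def)
    then show "x = y" by (simp add: fz)
  qed
  have "real (lattice_card K) / 4 = (\<Sum>x\<in>?L. measure lebesgue (A x))"
    by (simp add: lattice_card_def mA)
  also have "\<dots> = measure lebesgue (\<Union>x\<in>?L. A x)"
  proof (rule measure_UNION'[symmetric, OF fin Am])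
    show "pairwise (\<lambda>x y. disjnt (A x) (A y)) ?L"
      unfolding pairwise_def disjnt_def using disj by blast
  qed
  also have "\<dots> \<le> measure lebesgue K"
    using sub Am fin K(3)
    by (intro measure_mono_fmeasurable lmeasurable_compact sets.finite_UN) auto
  finally show ?thesis by simp
qed

lemma card_lattice_le_square:
  fixes n :: nat
  assumes K: "convex K" "\<forall>x\<in>K. - x \<in> K"
    and n: "n > 0" and no_multiple: "\<And>w. w \<in> lattice_Z2 \<Longrightarrow> real n *\<^sub>R w \<in> K \<Longrightarrow> w = 0"
  shows "lattice_card K \<le> (2 * n)\<^sup>2"
proof -
  define m where "m = 2 * int n"
  \<comment> \<open>On lattice points the floors change no value; they only pass to integers, where
    residues can be taken.\<close>
  define \<phi> where "\<phi> = (\<lambda>x :: real ^ 2. (\<lfloor>x $ 1\<rfloor> mod m, \<lfloor>x $ 2\<rfloor> mod m))"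
  have inj: "inj_on \<phi> (K \<inter> lattice_Z2)"
  proof (rule inj_onI)
    fix x y assume x: "x \<in> K \<inter> lattice_Z2" and y: "y \<in> K \<inter> lattice_Z2" and "\<phi> x = \<phi> y"
    then have "m dvd \<lfloor>x $ 1\<rfloor> - \<lfloor>y $ 1\<rfloor>" "m dvd \<lfloor>x $ 2\<rfloor> - \<lfloor>y $ 2\<rfloor>"
      by (auto simp: \<phi>_def mod_eq_dvd_iff)
    then obtain k l where kl: "\<lfloor>x $ 1\<rfloor> - \<lfloor>y $ 1\<rfloor> = m * k" "\<lfloor>x $ 2\<rfloor> - \<lfloor>y $ 2\<rfloor> = m * l"
      by (auto elim!: dvdE)
    define w :: "real ^ 2" where "w = vector [of_int k, of_int l]"
    have fl: "of_int \<lfloor>z $ i\<rfloor> = z $ i" if "z \<in> lattice_Z2" for z i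
      using that by (auto simp: lattice_Z2_def elim: Ints_cases)
    have "x - y = of_int m *\<^sub>R w"
      using arg_cong[OF kl(1), of real_of_int] arg_cong[OF kl(2), of real_of_int] x y
      by (simp add: vec_eq_iff forall_2 w_def fl)
    then have eq: "x - y = 2 *\<^sub>R (real n *\<^sub>R w)" by (simp add: m_def)
    \<comment> \<open>Symmetry and convexity put only half of \<open>x - y\<close> into
      \<open>K\<close>, which is why the modulus is \<open>2 * n\<close> rather than
      \<open>n\<close>.\<close>
    have "(1 / 2) *\<^sub>R x + (- 1 / 2) *\<^sub>R y \<in> K"
      using x y by (intro convex_symmetric_combination K) auto
    also have "(1 / 2) *\<^sub>R x + (- 1 / 2) *\<^sub>R y = (1 / 2) *\<^sub>R (x - y)" by (simp add: algebra_simps)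
    finally have "real n *\<^sub>R w \<in> K" by (simp add: eq)
    then have "w = 0" by (intro no_multiple) (auto simp: w_def lattice_Z2_iff)
    then show "x = y" using eq by simp
  qed
  have "\<phi> ` (K \<inter> lattice_Z2) \<subseteq> {0..<m} \<times> {0..<m}"
    using n by (auto simp: \<phi>_def m_def)
  then have "card (K \<inter> lattice_Z2) \<le> card ({0..<m} \<times> {0..<m})"
    by (intro card_inj_on_le[OF inj]) auto
  also have "\<dots> = (2 * n)\<^sup>2" by (simp add: m_def card_cartesian_product power2_eq_square nat_mult_distrib)
  finally show ?thesis by (simp add: lattice_card_def)
qed

lemma lattice_card_section_le_max:
  assumes "bounded K" "norm \<xi> = 1"
  shows "lattice_card (K \<inter> perp \<xi>) \<le> max_central_section K"
  unfolding max_central_section_def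
  using assms by (intro Max_ge finite_section_values) auto

text \<open>The segment from \<open>- n w\<close> to \<open>n w\<close> lies in \<open>K\<close> and
  contains the multiples \<open>j w\<close> with \<open>j\<close> from \<open>- n\<close> to
  \<open>n\<close>, all on the line through the origin with normal \<open>\<xi>\<close>.\<close>

lemma max_central_section_ge_multiple:
  fixes n :: nat
  assumes K: "convex K" "\<forall>x\<in>K. - x \<in> K" "bounded K"
    and w: "w \<in> lattice_Z2" "w \<noteq> 0" "real n *\<^sub>R w \<in> K"
  shows "2 * n + 1 \<le> max_central_section K"
proof -
  define \<eta> :: "real ^ 2" where "\<eta> = vector [- (w $ 2), w $ 1]"
  define \<xi> where "\<xi> = \<eta> /\<^sub>R norm \<eta>"
  have "\<eta> \<noteq> 0" using w(2) by (auto simp: \<eta>_def vec_eq_iff forall_2)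
  then have \<xi>: "norm \<xi> = 1" by (simp add: \<xi>_def)
  define h where "h = (\<lambda>j :: int. of_int j *\<^sub>R w)"
  have "inj_on h {- int n..int n}" using w(2) by (auto simp: h_def inj_on_def)
  moreover have "h ` {- int n..int n} \<subseteq> (K \<inter> perp \<xi>) \<inter> lattice_Z2"
  proof clarify
    fix j assume j: "j \<in> {- int n..int n}"
    have "(of_int j / real n) *\<^sub>R (real n *\<^sub>R w) + 0 *\<^sub>R (real n *\<^sub>R w) \<in> K"
    proof (intro convex_symmetric_combination K w)
      have "\<bar>real_of_int j\<bar> \<le> real n" using j by auto
      \<comment> \<open>For \<open>n = 0\<close> the quotient is 0 by the convention on division by
        zero, and only \<open>j = 0\<close> occurs.\<close>
      then show "\<bar>of_int j / real n\<bar> + \<bar>0\<bar> \<le> 1" by (cases "n = 0") simp_all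
    qed
    moreover have "(of_int j / real n) *\<^sub>R (real n *\<^sub>R w) = h j"
      using j by (cases "n = 0") (auto simp: h_def)
    ultimately have "h j \<in> K" by simp
    moreover have "h j \<in> perp \<xi>"
      by (simp add: h_def perp_def \<xi>_def \<eta>_def inner_vec_def sum_2)
    moreover have "h j \<in> lattice_Z2" using w by (simp add: h_def lattice_Z2_iff)
    ultimately show "h j \<in> (K \<inter> perp \<xi>) \<inter> lattice_Z2" by blast
  qed
  moreover have "finite ((K \<inter> perp \<xi>) \<inter> lattice_Z2)"
    using K(3) by (intro finite_Int_lattice_Z2 bounded_Int) auto
  ultimately have "card {- int n..int n} \<le> lattice_card (K \<inter> perp \<xi>)"
    unfolding lattice_card_def by (rule card_inj_on_le)
  also have "\<dots> \<le> max_central_section K"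
    using K(3) \<xi> by (rule lattice_card_section_le_max)
  finally show ?thesis by simp
qed

theorem theorem3:
  fixes K :: "(real ^ 2) set"
  assumes "convex_body K"
    and "origin_symmetric K"
    and "aff_dim (K \<inter> lattice_Z2) = 2"
  shows "real (lattice_card K)
           \<le> 4 * real (max_central_section K) * measure lebesgue K powr (1 / 2)"
proof -
  define N M V where "N = real (lattice_card K)" and "M = max_central_section K"
    and "V = measure lebesgue K"
  have K: "convex K" "compact K" using assms(1) by (auto simp: convex_body_def)
  have sym: "\<forall>x\<in>K. - x \<in> K"
    using assms(2) by (force simp: origin_symmetric_def)
  obtain a b where ab: "a \<in> K \<inter> lattice_Z2" "b \<in> K \<inter> lattice_Z2" "wedge a b \<noteq> 0"
    using wedge_nonzero_if_aff_dim_2[OF assms(3)] .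
  obtain u v where uv: "u \<in> K \<inter> lattice_Z2" "v \<in> K \<inter> lattice_Z2" "wedge u v = 1"
    using unimodular_pair_exists[OF K(1) sym ab] .
  have NV: "N \<le> 4 * V"
    unfolding N_def V_def using card_lattice_le_measure[OF K(1) sym K(2) uv] .
  note multiple = max_central_section_ge_multiple[OF K(1) sym compact_imp_bounded[OF K(2)]]
  have "u \<noteq> 0" using uv(3) by (auto simp: wedge_def)
  \<comment> \<open>The points \<open>- u\<close>, 0 and \<open>u\<close> share a line. This bound
    makes the \<open>n\<close> chosen next positive and gives \<open>M + 1 <= 2 * M\<close>.\<close>
  then have M: "M \<ge> 3"
    using multiple[of u 1] uv by (simp add: M_def)
  \<comment> \<open>This is the least \<open>n\<close> with \<open>2 * n + 1 > M\<close>, so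
    \<open>K\<close> contains no \<open>n\<close>-fold of a nonzero lattice vector. Rounding up
    costs at most one: \<open>2 * n <= M + 1\<close>.\<close>
  define n where "n = (M + 1) div 2"
  have "w = 0" if "w \<in> lattice_Z2" "real n *\<^sub>R w \<in> K" for w
  proof (rule ccontr)
    assume "w \<noteq> 0"
    then show False using multiple[OF that(1) _ that(2)] by (simp add: M_def[symmetric] n_def)
  qed
  then have "lattice_card K \<le> (2 * n)\<^sup>2"
    using M by (intro card_lattice_le_square K sym) (auto simp: n_def)
  also have "\<dots> \<le> (2 * M)\<^sup>2"
    using M by (intro power_mono) (auto simp: n_def)
  finally have NM: "N \<le> (2 * real M)\<^sup>2"
    unfolding N_def by (metis of_nat_le_iff of_nat_mult of_nat_numeral of_nat_power)
  have "N\<^sup>2 \<le> (2 * real M)\<^sup>2 * (4 * V)"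
    unfolding power2_eq_square[of N] using NM NV by (intro mult_mono) (auto simp: N_def)
  also have "\<dots> = (4 * real M * sqrt V)\<^sup>2"
    by (simp add: power_mult_distrib V_def)
  finally have "N \<le> 4 * real M * sqrt V"
    by (rule power2_le_imp_le) (simp add: V_def)
  then show ?thesis
    by (simp add: N_def M_def V_def powr_half_sqrt)
qed

end
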